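(* Let $f\in\mathbb{C}[x]$ be a polynomial of degree $n\ge 4$. If there exists a quadratic polynomial $q(x)\in\mathbb{C}[x]$ (of degree exactly $2$) such that $q(x)^2$ divides $f(x)$, then $W(f)\neq 0$.
   Context: $W(f)$ is the $\mathbb{C}$-vector space of all $p\in\mathbb{C}[x]$ of degree at most $n-2$ (including $0$) such that $f(x)$ divides $f''(x)p(x)-f'(x)p'(x)$. *)

theory Defs
  imports Complex_Main "HOL-Computational_Algebra.Polynomial"
begin

(* The bound degree p <= n - 2 is written additively, because subtraction on nat truncates:
   for n < 2 only the zero polynomial qualifies. *)
definition W :: "complex poly \<Rightarrow> complex poly set" where
  "W f = {p. (p = 0 \<or> degree p + 2 \<le> degree f) \<and>
             f dvd (pderiv (pderiv f) * p - pderiv f * pderiv p)}"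

interpretation cpoly: vector_space "smult :: complex \<Rightarrow> complex poly \<Rightarrow> complex poly"
  by unfold_locales (simp_all add: smult_add_right smult_add_left)

lemma subspace_W: "cpoly.subspace (W f)"
proof (rule cpoly.subspaceI)
  show "0 \<in> W f" by (simp add: W_def)
next
  fix p r assume p: "p \<in> W f" and r: "r \<in> W f"
  have "p + r = 0 \<or> degree (p + r) + 2 \<le> degree f"
    using p r degree_add_le_max[of p r] by (auto simp: W_def)
  moreover have "pderiv (pderiv f) * (p + r) - pderiv f * pderiv (p + r)
      = (pderiv (pderiv f) * p - pderiv f * pderiv p) + (pderiv (pderiv f) * r - pderiv f * pderiv r)"
    by (simp add: pderiv_add algebra_simps)
  ultimately show "p + r \<in> W f" using p r by (simp add: W_def)
next
  fix c p assume p: "p \<in> W f"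
  have "pderiv (pderiv f) * smult c p - pderiv f * pderiv (smult c p)
      = smult c (pderiv (pderiv f) * p - pderiv f * pderiv p)"
    by (simp add: pderiv_smult smult_diff_right)
  moreover have "smult c p = 0 \<or> degree (smult c p) + 2 \<le> degree f"
    using p by (auto simp: W_def)
  ultimately show "smult c p \<in> W f" using p by (simp add: W_def dvd_smult)
qed

end

theory Submission
  imports Defs
begin

text \<open>
  Write \<open>f = q\<^sup>2 u\<close> and look for elements of \<open>W f\<close> of the form \<open>p = q t\<close>. For these the
  terms of \<open>f'' p - f' p'\<close> that are not divisible by \<open>q\<^sup>2\<close> cancel, so that the condition on
  \<open>t\<close> only involves a remainder modulo \<open>u\<close>. As \<open>t\<close> ranges over a space of dimension
  \<open>deg u + 1\<close> and the remainders over one of dimension \<open>deg u\<close>, some nonzero \<open>t\<close> works.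
\<close>

text \<open>Taking the coefficient at \<open>i\<close> of a vanishing combination leaves only the
  scalar of \<open>monom 1 i\<close>.\<close>

lemma independent_monom: "cpoly.independent (range (monom 1))"
  unfolding cpoly.independent_explicit_module
proof (intro allI impI)
  fix c :: "complex poly \<Rightarrow> complex" and A p
  assume A: "finite A" "A \<subseteq> range (monom 1)" "(\<Sum>x\<in>A. smult (c x) x) = 0" and p: "p \<in> A"
  obtain i where i: "p = monom 1 i" using A p by auto
  have "coeff x i = (if x = p then 1 else 0)" if "x \<in> A" for x
    using that A(2) i by auto
  hence "(\<Sum>x\<in>A. c x * coeff x i) = (\<Sum>x\<in>A. if x = p then c x else 0)"
    by (intro sum.cong) auto
  moreover have "(\<Sum>x\<in>A. c x * coeff x i) = 0"
    using arg_cong[OF A(3), of "\<lambda>s. coeff s i"] by (simp add: coeff_sum)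
  ultimately show "c p = 0" using A(1) p by simp
qed

text \<open>The disjunct \<open>p = 0\<close> covers \<open>N = 0\<close>, where the span is {0}
  although \<open>degree 0 < 0\<close> fails.\<close>

lemma span_monom_lessThan:
  "cpoly.span (monom 1 ` {..<N}) = {p. p = 0 \<or> degree p < N}" (is "?S = ?P")
proof
  have "cpoly.subspace ?P"
    by (rule cpoly.subspaceI) (auto intro: degree_add_less)
  moreover have "monom 1 ` {..<N} \<subseteq> ?P" by (auto simp: degree_monom_eq)
  ultimately show "?S \<subseteq> ?P" by (rule cpoly.span_minimal[rotated])
  show "?P \<subseteq> ?S"
  proof
    fix p :: "complex poly" assume p: "p \<in> ?P"
    show "p \<in> ?S"
    proof (cases "p = 0")
      case False
      have "(\<Sum>i\<le>degree p. smult (coeff p i) (monom 1 i)) \<in> ?S"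
        using p False
        by (intro cpoly.span_sum cpoly.span_scale cpoly.span_base) auto
      thus ?thesis by (simp add: smult_monom poly_as_sum_of_monoms)
    qed (simp add: cpoly.span_zero)
  qed
qed

lemma linear_kernel_degree:
  fixes L :: "complex poly \<Rightarrow> complex poly"
  assumes lin: "Vector_Spaces.linear smult smult L"
    and deg: "\<And>p. L p = 0 \<or> degree (L p) < N"
  obtains t where "t \<noteq> 0" "degree t \<le> N" "L t = 0"
proof -
  interpret Vector_Spaces.linear smult smult L by (rule lin)
  let ?S = "monom 1 ` {..<Suc N} :: complex poly set"
  let ?T = "monom 1 ` {..<N} :: complex poly set"
  have inj_monom: "inj_on (monom (1::complex)) A" for A
    by (rule inj_onI) (metis degree_monom_eq zero_neq_one)
  \<comment> \<open>Injectivity would give \<open>Suc N\<close> independent images inside a span of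
    \<open>N\<close> monomials.\<close>
  have "\<not> inj_on L (cpoly.span ?S)"
  proof
    assume inj: "inj_on L (cpoly.span ?S)"
    have "cpoly.independent ?S"
      by (rule cpoly.independent_mono[OF independent_monom]) auto
    hence "cpoly.independent (L ` ?S)"
      using inj by (rule independent_injective_image)
    moreover have "L ` ?S \<subseteq> cpoly.span ?T" using deg by (auto simp: span_monom_lessThan)
    ultimately have "card (L ` ?S) \<le> card ?T"
      using cpoly.independent_span_bound[of ?T "L ` ?S"] by simp
    moreover have "card (L ` ?S) = Suc N"
      using inj_on_subset[OF inj cpoly.span_superset] by (simp add: card_image inj_monom)
    ultimately show False by (simp add: card_image inj_monom)
  qed
  then obtain t where "t \<in> cpoly.span ?S" "L t = 0" "t \<noteq> 0"
    using inj_on_iff_eq_0[OF cpoly.subspace_span] by blast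
  thus ?thesis using that unfolding span_monom_lessThan by auto
qed

text \<open>Both products contain \<open>2 * q * (pderiv q)\<^sup>2 * u * t\<close>, the only term
  with a single explicit factor \<open>q\<close>, and it cancels. The multiples of \<open>u\<close>
  are collected last, so that they drop out modulo \<open>u\<close>.\<close>

lemma square_factor_identity:
  fixes q u t :: "'a :: idom poly"
  defines "f \<equiv> q\<^sup>2 * u"
  shows "pderiv (pderiv f) * (q * t) - pderiv f * pderiv (q * t) =
    q\<^sup>2 * ((3 * pderiv q * pderiv u + q * pderiv (pderiv u)) * t - q * pderiv u * pderiv t
      + u * (2 * pderiv (pderiv q) * t - 2 * pderiv q * pderiv t))"
  unfolding f_def power2_eq_square by (simp add: pderiv_mult pderiv_add algebra_simps)

theorem corollary1p2:
  fixes f :: "complex poly" and n :: nat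
  assumes "degree f = n" and "n \<ge> 4"
    and "\<exists>q :: complex poly. degree q = 2 \<and> q ^ 2 dvd f"
  shows "W f \<noteq> {0}"
proof -
  obtain q u where q: "degree q = 2" and f: "f = q\<^sup>2 * u" using assms(3) unfolding dvd_def by blast
  have [simp]: "q \<noteq> 0" "u \<noteq> 0" using assms q f by auto
  have n: "degree f = 4 + degree u" by (simp add: f degree_mult_eq degree_power_eq q)
  \<comment> \<open>This is the part of the cofactor of \<open>q\<^sup>2\<close> not visibly
    divisible by \<open>u\<close>; reducing it modulo \<open>u\<close> bounds its degree and keeps
    it linear in \<open>t\<close>.\<close>
  define L where "L t = ((3 * pderiv q * pderiv u + q * pderiv (pderiv u)) * t
    - q * pderiv u * pderiv t) mod u" for t
  have "Vector_Spaces.linear smult smult L"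
  proof
    show "L (s + t) = L s + L t" for s t
      unfolding L_def poly_mod_add_left[symmetric] by (simp add: pderiv_add algebra_simps)
    show "L (smult c t) = smult c (L t)" for c t
      unfolding L_def mod_smult_left[symmetric] by (simp add: pderiv_smult smult_diff_right)
  qed
  \<comment> \<open>For constant \<open>u\<close> the first alternative always holds.\<close>
  moreover have "L t = 0 \<or> degree (L t) < degree u" for t
    unfolding L_def by (rule degree_mod_less) simp
  ultimately obtain t where t: "t \<noteq> 0" "degree t \<le> degree u" "L t = 0"
    by (rule linear_kernel_degree)
  have "u dvd (3 * pderiv q * pderiv u + q * pderiv (pderiv u)) * t - q * pderiv u * pderiv t"
    using t(3) by (simp add: L_def mod_eq_0_iff_dvd)
  hence "f dvd pderiv (pderiv f) * (q * t) - pderiv f * pderiv (q * t)"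
    unfolding f square_factor_identity by (intro mult_dvd_mono dvd_add) auto
  \<comment> \<open>The bound is met exactly when \<open>degree t = degree u\<close>: two degrees
    come from \<open>q\<close>, and \<open>f\<close> has degree \<open>4 + degree u\<close>.\<close>
  moreover have "degree (q * t) + 2 \<le> degree f"
    using t by (simp add: n degree_mult_eq q)
  ultimately have "q * t \<in> W f" by (simp add: W_def)
  moreover have "q * t \<noteq> 0" using t by simp
  ultimately show ?thesis by blast
qed

end
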